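(* Let the day-ahead quantities $\mu_{et}^c,\mu_{et}^d\in\{0,1\}$, $\underline{E}_{et}^{DA},\overline{E}_{et}^{DA}$, $\underline{p}_{et}^{DA,c},\overline{p}_{et}^{DA,c}$, $\underline{p}_{et}^{DA,d},\overline{p}_{et}^{DA,d}$ ($e\in\mathcal{E}$, $t\in\mathcal{T}$) satisfy the day-ahead energy storage constraints (a)-(g) listed in the context. Suppose that for every $e\in\mathcal{E}$ and every period $t\in\mathcal{T}$ the real-time charging power $p_{et}^c$ and discharging power $p_{et}^d$ satisfy $$\underline{p}_{et}^{DA,c}\le p_{et}^c\le \overline{p}_{et}^{DA,c},\qquad \underline{p}_{et}^{DA,d}\le p_{et}^d\le \overline{p}_{et}^{DA,d}.$$ Then the resulting real-time states of charge $E_{et}$, defined by $$E_{et}=E_{e,t-1}+\bigl(p_{et}^c\eta_e^c-p_{et}^d/\eta_e^d\bigr)\Delta t,$$ satisfy $\underline{E}_e\le E_{et}\le\overline{E}_e$ for all $e\in\mathcal{E}$ and all $t\in\mathcal{T}$.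
   Context: $\mathcal{E}$ is a finite set of energy storage units and $\mathcal{T}=\{1,\dots,T\}$ is the set of periods. For each $e$ the following are given real parameters: charging/discharging efficiencies $\eta_e^c,\eta_e^d>0$, period length $\Delta t>0$, physical SOC (state-of-charge) limits $\underline{E}_e\le\overline{E}_e$, power limits $\underline{p}_e^c,\overline{p}_e^c,\underline{p}_e^d,\overline{p}_e^d$, terminal tolerance $\Delta_e$, and initial SOC $E_{e0}$, with the convention $\underline{E}_{e0}^{DA}=\overline{E}_{e0}^{DA}=E_{e0}$. Day-ahead energy storage constraints, for all $e\in\mathcal{E}$, $t\in\mathcal{T}$: (a) $\underline{E}_{et}^{DA}=\underline{E}_{e,t-1}^{DA}+(\underline{p}_{et}^{DA,c}\eta_e^c-\overline{p}_{et}^{DA,d}/\eta_e^d)\Delta t$; (b) $\overline{E}_{et}^{DA}=\overline{E}_{e,t-1}^{DA}+(\overline{p}_{et}^{DA,c}\eta_e^c-\underline{p}_{et}^{DA,d}/\eta_e^d)\Delta t$; (c) $\mu_{et}^c+\mu_{et}^d\le 1$; (d) $\mu_{et}^c\underline{p}_e^c\le\underline{p}_{et}^{DA,c}\le\overline{p}_{et}^{DA,c}\le\mu_{et}^c\overline{p}_e^c$; (e) $\mu_{et}^d\underline{p}_e^d\le\underline{p}_{et}^{DA,d}\le\overline{p}_{et}^{DA,d}\le\mu_{et}^d\overline{p}_e^d$; (f) $\underline{E}_e\le\underline{E}_{et}^{DA}\le\overline{E}_{et}^{DA}\le\overline{E}_e$; (g) $-\Delta_e\le\underline{E}_{eT}^{DA}-E_{e0}\le\overline{E}_{eT}^{DA}-E_{e0}\le\Delta_e$.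 *)

theory Defs
  imports Complex_Main
begin

record 'e storage_data =
  units :: "'e set"
  horizon :: nat
  period_length :: real
  eff_c :: "'e \<Rightarrow> real"
  eff_d :: "'e \<Rightarrow> real"
  soc_min :: "'e \<Rightarrow> real"
  soc_max :: "'e \<Rightarrow> real"
  soc_init :: "'e \<Rightarrow> real"
  pc_min :: "'e \<Rightarrow> real"
  pc_max :: "'e \<Rightarrow> real"
  pd_min :: "'e \<Rightarrow> real"
  pd_max :: "'e \<Rightarrow> real"
  terminal_tol :: "'e \<Rightarrow> real"

definition periods :: "'e storage_data \<Rightarrow> nat set" where
  "periods S = {1..horizon S}"

definition valid_storage_data :: "'e storage_data \<Rightarrow> bool" where
  "valid_storage_data S \<longleftrightarrow>
     finite (units S) \<and> 1 \<le> horizon S \<and> 0 < period_length S \<and>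
     (\<forall>e\<in>units S. 0 < eff_c S e \<and> 0 < eff_d S e \<and> soc_min S e \<le> soc_max S e)"

text \<open>
  In a day-ahead schedule the second argument is the period.  The SOC bounds are also used at
  index \<open>0\<close>, the initial state; values at indices outside \<open>periods\<close> are otherwise irrelevant.
  The charging and discharging indicators are real-valued so that they can multiply power limits;
  that they are binary is stated by \<open>binary_modes\<close>.
\<close>

record 'e da_schedule =
  mode_c :: "'e \<Rightarrow> nat \<Rightarrow> real"
  mode_d :: "'e \<Rightarrow> nat \<Rightarrow> real"
  soc_lo :: "'e \<Rightarrow> nat \<Rightarrow> real"
  soc_up :: "'e \<Rightarrow> nat \<Rightarrow> real"
  pc_lo :: "'e \<Rightarrow> nat \<Rightarrow> real"
  pc_up :: "'e \<Rightarrow> nat \<Rightarrow> real"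
  pd_lo :: "'e \<Rightarrow> nat \<Rightarrow> real"
  pd_up :: "'e \<Rightarrow> nat \<Rightarrow> real"

definition binary_modes :: "'e storage_data \<Rightarrow> 'e da_schedule \<Rightarrow> bool" where
  "binary_modes S D \<longleftrightarrow>
     (\<forall>e\<in>units S. \<forall>t\<in>periods S. mode_c D e t \<in> {0, 1} \<and> mode_d D e t \<in> {0, 1})"

definition da_initial :: "'e storage_data \<Rightarrow> 'e da_schedule \<Rightarrow> bool" where
  "da_initial S D \<longleftrightarrow>
     (\<forall>e\<in>units S. soc_lo D e 0 = soc_init S e \<and> soc_up D e 0 = soc_init S e)"

text \<open>The lower SOC trajectory pairs least charging with greatest discharging, the upper one
  greatest charging with least discharging.\<close>

definition da_constraints :: "'e storage_data \<Rightarrow> 'e da_schedule \<Rightarrow> bool" where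
  "da_constraints S D \<longleftrightarrow>
     (\<forall>e\<in>units S. \<forall>t\<in>periods S.
        soc_lo D e t = soc_lo D e (t - 1)
          + (pc_lo D e t * eff_c S e - pd_up D e t / eff_d S e) * period_length S \<and>
        soc_up D e t = soc_up D e (t - 1)
          + (pc_up D e t * eff_c S e - pd_lo D e t / eff_d S e) * period_length S \<and>
        mode_c D e t + mode_d D e t \<le> 1 \<and>
        mode_c D e t * pc_min S e \<le> pc_lo D e t \<and>
        pc_lo D e t \<le> pc_up D e t \<and>
        pc_up D e t \<le> mode_c D e t * pc_max S e \<and>
        mode_d D e t * pd_min S e \<le> pd_lo D e t \<and>
        pd_lo D e t \<le> pd_up D e t \<and>
        pd_up D e t \<le> mode_d D e t * pd_max S e \<and>
        soc_min S e \<le> soc_lo D e t \<and>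
        soc_lo D e t \<le> soc_up D e t \<and>
        soc_up D e t \<le> soc_max S e) \<and>
     (\<forall>e\<in>units S.
        - terminal_tol S e \<le> soc_lo D e (horizon S) - soc_init S e \<and>
        soc_lo D e (horizon S) - soc_init S e \<le> soc_up D e (horizon S) - soc_init S e \<and>
        soc_up D e (horizon S) - soc_init S e \<le> terminal_tol S e)"

primrec rt_soc ::
  "'e storage_data \<Rightarrow> ('e \<Rightarrow> nat \<Rightarrow> real) \<Rightarrow> ('e \<Rightarrow> nat \<Rightarrow> real) \<Rightarrow> 'e \<Rightarrow> nat \<Rightarrow> real" where
  "rt_soc S pc pd e 0 = soc_init S e"
| "rt_soc S pc pd e (Suc t) = rt_soc S pc pd e t
     + (pc e (Suc t) * eff_c S e - pd e (Suc t) / eff_d S e) * period_length S"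

end

theory Submission
  imports Defs
begin

text \<open>Because the efficiencies and the period length are positive, the SOC gained in one
  period increases with charging power and decreases with discharging power
  (\<open>soc_increment_mono\<close>). The two day-ahead trajectories take the opposite extreme
  power choices and start from the same SOC as the real-time one, so by induction on time they
  enclose it (\<open>rt_soc_between_da_soc\<close>). The physical limits enclose the day-ahead
  trajectories in turn.\<close>

lemma soc_increment_mono:
  fixes c c' d d' a b \<tau> :: real
  assumes "c \<le> c'" "d' \<le> d" "0 < a" "0 < b" "0 < \<tau>"
  shows "(c * a - d / b) * \<tau> \<le> (c' * a - d' / b) * \<tau>"
  using assms by (intro mult_right_mono diff_mono divide_right_mono) auto

text \<open>The range of \<open>t\<close> includes 0, which is not a period, so that the induction
  can start where all three trajectories equal \<open>soc_init S e\<close>.\<close>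

lemma rt_soc_between_da_soc:
  assumes valid: "valid_storage_data S" and init: "da_initial S D" and da: "da_constraints S D"
    and pc: "\<forall>e\<in>units S. \<forall>t\<in>periods S. pc_lo D e t \<le> pc e t \<and> pc e t \<le> pc_up D e t"
    and pd: "\<forall>e\<in>units S. \<forall>t\<in>periods S. pd_lo D e t \<le> pd e t \<and> pd e t \<le> pd_up D e t"
    and e: "e \<in> units S" and t: "t \<le> horizon S"
  shows "soc_lo D e t \<le> rt_soc S pc pd e t \<and> rt_soc S pc pd e t \<le> soc_up D e t"
  using t
proof (induction t)
  case 0
  then show ?case using init e by (simp add: da_initial_def)
next
  case (Suc t)
  have per: "Suc t \<in> periods S" using Suc.prems by (simp add: periods_def)
  have pos: "0 < eff_c S e" "0 < eff_d S e" "0 < period_length S"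
    using valid e by (auto simp: valid_storage_data_def)
  \<comment> \<open>The constraints write the predecessor as \<open>t - 1\<close>; at
    \<open>Suc t\<close> it is \<open>t\<close>, which for the first period is the initial index
    0.\<close>
  have lo: "soc_lo D e (Suc t) = soc_lo D e t
      + (pc_lo D e (Suc t) * eff_c S e - pd_up D e (Suc t) / eff_d S e) * period_length S"
    and up: "soc_up D e (Suc t) = soc_up D e t
      + (pc_up D e (Suc t) * eff_c S e - pd_lo D e (Suc t) / eff_d S e) * period_length S"
    using da e per unfolding da_constraints_def by (metis diff_Suc_1)+
  have power: "pc_lo D e (Suc t) \<le> pc e (Suc t)" "pc e (Suc t) \<le> pc_up D e (Suc t)"
    "pd_lo D e (Suc t) \<le> pd e (Suc t)" "pd e (Suc t) \<le> pd_up D e (Suc t)"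
    using pc pd e per by auto
  \<comment> \<open>Lower bound: least charging with greatest discharging, facts 1 and 4 of
    \<open>power\<close>. Upper bound: the reverse, facts 2 and 3.\<close>
  show ?case
    using Suc soc_increment_mono[OF power(1,4) pos] soc_increment_mono[OF power(2,3) pos]
    by (simp add: lo up add_mono)
qed

theorem proposition1:
  fixes S :: "'e storage_data" and D :: "'e da_schedule"
    and pc pd :: "'e \<Rightarrow> nat \<Rightarrow> real"
  assumes "valid_storage_data S"
    and "binary_modes S D"
    and "da_initial S D"
    and "da_constraints S D"
    and "\<forall>e\<in>units S. \<forall>t\<in>periods S. pc_lo D e t \<le> pc e t \<and> pc e t \<le> pc_up D e t"
    and "\<forall>e\<in>units S. \<forall>t\<in>periods S. pd_lo D e t \<le> pd e t \<and> pd e t \<le> pd_up D e t"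
  shows "\<forall>e\<in>units S. \<forall>t\<in>periods S.
           soc_min S e \<le> rt_soc S pc pd e t \<and> rt_soc S pc pd e t \<le> soc_max S e"
proof (intro ballI)
  fix e t
  assume e: "e \<in> units S" and t: "t \<in> periods S"
  have "soc_lo D e t \<le> rt_soc S pc pd e t \<and> rt_soc S pc pd e t \<le> soc_up D e t"
    using rt_soc_between_da_soc[OF assms(1,3-6) e] t by (simp add: periods_def)
  moreover have "soc_min S e \<le> soc_lo D e t" "soc_up D e t \<le> soc_max S e"
    using assms(4) e t unfolding da_constraints_def by blast+
  ultimately show "soc_min S e \<le> rt_soc S pc pd e t \<and> rt_soc S pc pd e t \<le> soc_max S e"
    by linarith
qed

end
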